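(* Let $\Delta\ge 3$ and $c=0$ (palette $[\Delta]$). Any deterministic shift-based algorithm maintaining a proper $\Delta$-edge-coloring of an incremental forest of maximum degree at most $\Delta$ on $n$ vertices has, on some insertion sequence, amortized recourse $\Omega\!\left(\frac{1}{\Delta}\log\frac{n}{\Delta^3}\right)$.
   Context: A dynamic forest on $n$ fixed vertices starts empty; in the incremental model each update inserts an edge joining two distinct trees, with maximum degree always at most $\Delta$. Recourse of an update is the number of previously colored edges whose color changes; amortized recourse is total recourse divided by the number of updates. An algorithm is shift-based if upon each insertion it extends the coloring only by a chain of color shifts: starting with the new edge as the current uncolored edge $e'=(u,v)$, it assigns to $e'$ a color that is available (unused) at $u$ or at $v$; if the color is available at both endpoints the process ends, and otherwise the unique edge at the other endpoint having that color is uncolored and becomes the current uncolored edge. (In particular it never colors an edge by a color used at both of its endpoints.) *)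

theory Defs
  imports Complex_Main
begin

text \<open>
  Graphs on the vertices \<open>0, \<dots>, n - 1\<close> are given by their sets of edges, an edge being the set of its
  two endpoints.  A partial edge coloring maps an edge to \<^term>\<open>None\<close> if it is absent or currently
  uncolored.
\<close>

type_synonym edge = "nat set"
type_synonym coloring = "edge \<Rightarrow> nat option"

definition adjacency :: "edge set \<Rightarrow> (nat \<times> nat) set" where
  "adjacency E = {(u, v). {u, v} \<in> E}"

definition degree :: "edge set \<Rightarrow> nat \<Rightarrow> nat" where
  "degree E v = card {e \<in> E. v \<in> e}"

text \<open>
  In an insertion, the endpoints lie in distinct trees iff they are not connected; by reflexivity of
  the closure this includes \<open>u \<noteq> v\<close>.
\<close>

inductive insertion_sequence :: "nat \<Rightarrow> nat \<Rightarrow> edge list \<Rightarrow> bool" for n \<Delta> where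
  empty: "insertion_sequence n \<Delta> []"
| insert: "insertion_sequence n \<Delta> (es @ [{u, v}])"
    if "insertion_sequence n \<Delta> es"
      and "u < n" and "v < n"
      and "(u, v) \<notin> (adjacency (set es))\<^sup>*"
      and "\<forall>w. degree (insert {u, v} (set es)) w \<le> \<Delta>"

definition proper_edge_coloring :: "nat \<Rightarrow> edge set \<Rightarrow> coloring \<Rightarrow> bool" where
  "proper_edge_coloring \<Delta> E C \<longleftrightarrow>
     dom C = E \<and> ran C \<subseteq> {1..\<Delta>} \<and>
     (\<forall>e\<in>E. \<forall>f\<in>E. e \<noteq> f \<longrightarrow> e \<inter> f \<noteq> {} \<longrightarrow> C e \<noteq> C f)"

definition available :: "nat \<Rightarrow> coloring \<Rightarrow> nat \<Rightarrow> nat \<Rightarrow> bool" where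
  "available \<Delta> C w c \<longleftrightarrow> c \<in> {1..\<Delta>} \<and> (\<forall>f. w \<in> f \<longrightarrow> C f \<noteq> Some c)"

text \<open>
  \<open>shift_chain \<Delta> C e C'\<close>: from the partial coloring \<open>C\<close> with current uncolored edge \<open>e\<close>, some finite
  chain of color shifts ends in \<open>C'\<close>.  Because \<open>{u, v} = {v, u}\<close>, the vertex \<open>u\<close> in \<open>shift\<close> can be
  either endpoint of \<open>e\<close>.
\<close>

inductive shift_chain :: "nat \<Rightarrow> coloring \<Rightarrow> edge \<Rightarrow> coloring \<Rightarrow> bool" for \<Delta> where
  finish: "shift_chain \<Delta> C {u, v} (C({u, v} \<mapsto> c))"
    if "available \<Delta> C u c" and "available \<Delta> C v c"
| shift: "shift_chain \<Delta> C {u, v} C'"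
    if "available \<Delta> C u c"
      and "v \<in> f" and "C f = Some c"
      and "shift_chain \<Delta> ((C({u, v} \<mapsto> c))(f := None)) f C'"

text \<open>
  A deterministic algorithm is determined by the coloring it holds after each history of insertions.
\<close>

type_synonym algorithm = "edge list \<Rightarrow> coloring"

definition maintains_proper_coloring :: "nat \<Rightarrow> nat \<Rightarrow> algorithm \<Rightarrow> bool" where
  "maintains_proper_coloring n \<Delta> A \<longleftrightarrow>
     (\<forall>es. insertion_sequence n \<Delta> es \<longrightarrow> proper_edge_coloring \<Delta> (set es) (A es))"

definition shift_based :: "nat \<Rightarrow> nat \<Rightarrow> algorithm \<Rightarrow> bool" where
  "shift_based n \<Delta> A \<longleftrightarrow>
     (\<forall>es e. insertion_sequence n \<Delta> (es @ [e]) \<longrightarrow> shift_chain \<Delta> (A es) e (A (es @ [e])))"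

definition recourse :: "coloring \<Rightarrow> coloring \<Rightarrow> nat" where
  "recourse C C' = card {e \<in> dom C. C' e \<noteq> C e}"

definition total_recourse :: "algorithm \<Rightarrow> edge list \<Rightarrow> nat" where
  "total_recourse A es = (\<Sum>i<length es. recourse (A (take i es)) (A (take (Suc i) es)))"

definition amortized_recourse :: "algorithm \<Rightarrow> edge list \<Rightarrow> real" where
  "amortized_recourse A es = real (total_recourse A es) / real (length es)"

end

theory Submission
  imports Defs "HOL-Library.Disjoint_Sets"
begin

text \<open>
  Take many stars with \<open>\<Delta> - 2\<close> leaves, so that each center misses exactly two colors, and group the stars
  by their missing pair \<open>M\<close>.  While the centers of one group are joined to a path, every shift chain
  stays on path edges, and these are colored alternately from \<open>M\<close>.  Two paths with the same odd
  number of vertices can be joined at ends whose last edges have different colors, which forces one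
  of the paths to be recolored entirely; one further star makes the number of vertices odd again.
  By doubling, a group of about \<open>2 ^ k\<close> stars costs on the order of \<open>k * 2 ^ k\<close> color changes.  Since
  there are fewer than \<open>\<Delta>\<^sup>2\<close> pairs, half of about \<open>n / \<Delta>\<close> stars can be processed in groups of size about
  \<open>n / \<Delta> ^ 3\<close>.  If \<open>n / \<Delta> ^ 3\<close> is bounded, a single color change among \<open>2 * \<Delta>\<close> insertions suffices.
\<close>

section \<open>Insertion sequences and colorings\<close>

lemma insertion_sequence_prefix:
  "insertion_sequence n \<Delta> (es @ fs) \<Longrightarrow> insertion_sequence n \<Delta> es"
proof (induction fs rule: rev_induct)
  case (snoc f fs)
  from snoc.prems have "insertion_sequence n \<Delta> ((es @ fs) @ [f])" by simp
  then have "insertion_sequence n \<Delta> (es @ fs)"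
    by (cases rule: insertion_sequence.cases) auto
  then show ?case by (rule snoc.IH)
qed simp

lemma insertion_sequence_degree:
  "insertion_sequence n \<Delta> es \<Longrightarrow> degree (set es) w \<le> \<Delta>"
  by (induction rule: insertion_sequence.induct) (auto simp: degree_def)

lemma degree_insert_le:
  "finite E \<Longrightarrow> degree (insert e E) w \<le> (if w \<in> e then Suc (degree E w) else degree E w)"
proof (cases "w \<in> e")
  case True
  assume "finite E"
  have "{f \<in> insert e E. w \<in> f} = insert e {f \<in> E. w \<in> f}" using True by auto
  then show ?thesis using True \<open>finite E\<close> by (simp add: degree_def card_insert_le_m1 card_insert_if)
next
  case False
  then have "{f \<in> insert e E. w \<in> f} = {f \<in> E. w \<in> f}" by auto
  then show ?thesis using False by (simp add: degree_def)
qed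

lemma degree_untouched:
  "\<forall>e\<in>F. x \<notin> e \<Longrightarrow> degree (E \<union> F) x = degree E x"
  unfolding degree_def by (rule arg_cong[where f = card]) auto

text \<open>Such sets are unions of connected components, so one that contains \<open>u\<close> but
  not \<open>v\<close> certifies that \<open>u\<close> and \<open>v\<close> lie in distinct
  trees.\<close>

definition closed_under :: "edge set \<Rightarrow> nat set \<Rightarrow> bool" where
  "closed_under E S \<longleftrightarrow> (\<forall>e\<in>E. e \<inter> S \<noteq> {} \<longrightarrow> e \<subseteq> S)"

lemma closed_under_reachable:
  assumes "closed_under E S" "(u, v) \<in> (adjacency E)\<^sup>*" "u \<in> S"
  shows "v \<in> S"
  using assms(2,3)
proof (induction rule: rtrancl_induct)
  case (step y z)
  then have "{y, z} \<in> E" by (simp add: adjacency_def)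
  with step assms(1) show ?case unfolding closed_under_def by fastforce
qed

lemma insertion_sequence_snoc:
  assumes es: "insertion_sequence n \<Delta> es" and "u < n" "v < n"
    and S: "closed_under (set es) S" "u \<in> S" "v \<notin> S"
    and deg: "degree (set es) u < \<Delta>" "degree (set es) v < \<Delta>"
  shows "insertion_sequence n \<Delta> (es @ [{u, v}])"
proof (rule insertion_sequence.insert[OF es assms(2,3)])
  show "(u, v) \<notin> (adjacency (set es))\<^sup>*"
    using closed_under_reachable[OF S(1)] S(2,3) by blast
  show "\<forall>w. degree (insert {u, v} (set es)) w \<le> \<Delta>"
  proof
    fix w
    have "degree (insert {u, v} (set es)) w
        \<le> (if w \<in> {u, v} then Suc (degree (set es) w) else degree (set es) w)"
      by (rule degree_insert_le) simp
    also have "\<dots> \<le> \<Delta>"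
      using deg insertion_sequence_degree[OF es, of w] by auto
    finally show "degree (insert {u, v} (set es)) w \<le> \<Delta>" .
  qed
qed

lemma total_recourse_snoc:
  "total_recourse A (es @ [e]) = total_recourse A es + recourse (A es) (A (es @ [e]))"
  by (simp add: total_recourse_def)

lemma total_recourse_mono: "total_recourse A es \<le> total_recourse A (es @ fs)"
proof (induction fs rule: rev_induct)
  case (snoc f fs)
  then show ?case using total_recourse_snoc[of A "es @ fs" f] by simp
qed simp

section \<open>Colors at a vertex, and color pairs reserved for a vertex set\<close>

definition used :: "coloring \<Rightarrow> nat \<Rightarrow> nat set" where
  "used C x = {c. \<exists>f. x \<in> f \<and> C f = Some c}"

lemma proper_dom: "proper_edge_coloring \<Delta> E C \<Longrightarrow> dom C = E"
  and proper_range: "proper_edge_coloring \<Delta> E C \<Longrightarrow> C e = Some c \<Longrightarrow> c \<in> {1..\<Delta>}"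
  and proper_neq: "proper_edge_coloring \<Delta> E C \<Longrightarrow> e \<in> E \<Longrightarrow> f \<in> E \<Longrightarrow> x \<in> e \<Longrightarrow> x \<in> f \<Longrightarrow>
    e \<noteq> f \<Longrightarrow> C e \<noteq> C f"
  unfolding proper_edge_coloring_def ran_def by blast+

lemma used_subset: "proper_edge_coloring \<Delta> E C \<Longrightarrow> used C x \<subseteq> {1..\<Delta>}"
  using proper_range unfolding used_def by blast

lemma card_used:
  assumes "proper_edge_coloring \<Delta> E C"
  shows "card (used C x) = degree E x"
proof -
  have "bij_betw (\<lambda>e. the (C e)) {e \<in> E. x \<in> e} (used C x)"
    unfolding bij_betw_def
  proof
    show "inj_on (\<lambda>e. the (C e)) {e \<in> E. x \<in> e}"
    proof (rule inj_onI)
      fix e f assume e: "e \<in> {e \<in> E. x \<in> e}" and f: "f \<in> {e \<in> E. x \<in> e}"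
        and eq: "the (C e) = the (C f)"
      have "e \<in> dom C" "f \<in> dom C" using e f proper_dom[OF assms] by auto
      then have "C e = C f" using eq by auto
      then show "e = f" using proper_neq[OF assms] e f by blast
    qed
    show "(\<lambda>e. the (C e)) ` {e \<in> E. x \<in> e} = used C x"
    proof -
      have "dom C = E" using proper_dom[OF assms] .
      then show ?thesis unfolding used_def by (force simp: image_iff dom_def)
    qed
  qed
  then show ?thesis by (simp add: degree_def bij_betw_same_card)
qed

text \<open>\<open>V\<close> will be a group of star centers and \<open>M\<close> their common
  missing pair: at each vertex of \<open>V\<close>, the edges leaving \<open>V\<close> take all
  palette colors outside \<open>M\<close> and none in \<open>M\<close>. Only edges not contained in
  \<open>V\<close> are mentioned, so recoloring inside \<open>V\<close> preserves the
  property.\<close>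

definition reserved :: "nat \<Rightarrow> coloring \<Rightarrow> nat set \<Rightarrow> nat set \<Rightarrow> bool" where
  "reserved \<Delta> C V M \<longleftrightarrow>
     (\<forall>x\<in>V. \<forall>c\<in>{1..\<Delta>} - M. \<exists>f. x \<in> f \<and> \<not> f \<subseteq> V \<and> C f = Some c) \<and>
     (\<forall>f c. f \<inter> V \<noteq> {} \<longrightarrow> \<not> f \<subseteq> V \<longrightarrow> C f = Some c \<longrightarrow> c \<notin> M)"

lemma reserved_cong:
  assumes "reserved \<Delta> C V M" and "\<And>f. \<not> f \<subseteq> V \<Longrightarrow> C' f = C f"
  shows "reserved \<Delta> C' V M"
  using assms unfolding reserved_def by metis

lemma reserved_available:
  "reserved \<Delta> C V M \<Longrightarrow> x \<in> V \<Longrightarrow> available \<Delta> C x c \<Longrightarrow> c \<in> M"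
  unfolding reserved_def available_def by blast

text \<open>A color available at a vertex of \<open>V\<close> lies in \<open>M\<close>, and an edge
  of such a color that meets \<open>V\<close> lies inside \<open>V\<close>. So the uncolored edge
  never escapes from \<open>V\<close>.\<close>

lemma shift_chain_reserved:
  assumes "shift_chain \<Delta> C e C'" "e \<subseteq> V" "reserved \<Delta> C V M" "\<not> g \<subseteq> V"
  shows "C' g = C g"
  using assms
proof (induction rule: shift_chain.induct)
  case (finish C u c v)
  then show ?case by auto
next
  case (shift C u c v f C')
  let ?C = "(C({u, v} \<mapsto> c))(f := None)"
  have "c \<in> M" using reserved_available shift by blast
  then have f: "f \<subseteq> V"
    using shift.hyps(2,3) shift.prems(1,2) unfolding reserved_def by blast
  have "reserved \<Delta> ?C V M"
    by (rule reserved_cong[OF shift.prems(2)]) (use f shift.prems(1) in auto)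
  then have "C' g = ?C g" using shift.IH f shift.prems(3) by blast
  then show ?case using f shift.prems(1,3) by auto
qed

section \<open>Alternating paths\<close>

lemma card_2_eq_iff:
  assumes "card M = 2" "a \<in> M" "b \<in> M" "c \<in> M" "d \<in> M" "a \<noteq> b" "c \<noteq> d"
  shows "b = d \<longleftrightarrow> a = c"
proof -
  obtain x y where "M = {x, y}" using assms(1) by (auto simp: card_2_iff)
  with assms(2-) show ?thesis by blast
qed

definition alternating :: "'a set \<Rightarrow> (nat \<Rightarrow> 'a) \<Rightarrow> nat \<Rightarrow> bool" where
  "alternating M f m \<longleftrightarrow> (\<forall>i<m. f i \<in> M) \<and> (\<forall>i. Suc i < m \<longrightarrow> f i \<noteq> f (Suc i))"

text \<open>Over two symbols each entry determines the next, so two alternating sequences agree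
  everywhere or nowhere. This is why one recolored link forces the recoloring of a whole
  path.\<close>

lemma alternating_eq_iff:
  assumes M: "card M = 2" and f: "alternating M f m" and g: "alternating M g m" and "i < m"
  shows "f i = g i \<longleftrightarrow> f 0 = g 0"
  using \<open>i < m\<close>
proof (induction i)
  case (Suc i)
  have "f (Suc i) = g (Suc i) \<longleftrightarrow> f i = g i"
    by (rule card_2_eq_iff[OF M]) (use f g Suc.prems in \<open>simp_all add: alternating_def\<close>)
  with Suc show ?case by simp
qed simp

lemma alternating_parity:
  assumes M: "card M = 2" and f: "alternating M f m" and "i < m"
  shows "f i = f 0 \<longleftrightarrow> even i"
  using \<open>i < m\<close>
proof (induction i)
  case (Suc i)
  obtain a b where ab: "M = {a, b}" using M by (auto simp: card_2_iff)
  have "f i \<in> M" "f (Suc i) \<in> M" "f 0 \<in> M" "f i \<noteq> f (Suc i)"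
    using f Suc.prems by (simp_all add: alternating_def)
  then have "f (Suc i) = f 0 \<longleftrightarrow> f i \<noteq> f 0"
    unfolding ab by (metis empty_iff insert_iff)
  with Suc show ?case by simp
qed simp

definition link :: "nat list \<Rightarrow> nat \<Rightarrow> edge" where
  "link xs i = {xs ! i, xs ! Suc i}"

lemma inj_on_link:
  assumes "distinct xs"
  shows "inj_on (link xs) {..<length xs - 1}"
proof (rule inj_onI)
  fix i j assume "i \<in> {..<length xs - 1}" "j \<in> {..<length xs - 1}" "link xs i = link xs j"
  then have "Suc i < length xs" "Suc j < length xs"
    "{xs ! i, xs ! Suc i} = {xs ! j, xs ! Suc j}" by (auto simp: link_def)
  then show "i = j" using assms by (auto simp: doubleton_eq_iff nth_eq_iff_index_eq)
qed

lemma link_append1: "Suc i < length ps \<Longrightarrow> link (ps @ qs) i = link ps i"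
  by (simp add: link_def nth_append)

lemma link_append2: "link (ps @ qs) (length ps + i) = link qs i"
  by (simp add: link_def nth_append)

lemma link_rev:
  assumes "Suc i < length xs"
  shows "link (rev xs) i = link xs (length xs - 2 - i)"
proof -
  define j where "j = length xs - 2 - i"
  then have "length xs = Suc (Suc (i + j))" using assms by simp
  then show ?thesis by (simp add: link_def rev_nth insert_commute)
qed

text \<open>A palette color outside \<open>M\<close> already occurs, at any endpoint of
  \<open>e\<close>, on an edge leaving \<open>V\<close>; properness excludes it from
  \<open>e\<close>.\<close>

lemma reserved_edge_color:
  assumes C: "proper_edge_coloring \<Delta> E C" and V: "reserved \<Delta> C V M"
    and e: "e \<in> E" "e \<subseteq> V" "e \<noteq> {}"
  shows "C e \<in> Some ` M"
proof -
  obtain c where c: "C e = Some c" using e(1) proper_dom[OF C] by blast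
  have "c \<in> M"
  proof (rule ccontr)
    assume "c \<notin> M"
    then have "c \<in> {1..\<Delta>} - M" using proper_range[OF C c] by simp
    moreover obtain x where x: "x \<in> e" using e(3) by blast
    moreover have "x \<in> V" using x e(2) by blast
    ultimately obtain f where f: "x \<in> f" "\<not> f \<subseteq> V" "C f = Some c"
      using V unfolding reserved_def by meson
    then have "f \<in> E" using proper_dom[OF C] by blast
    then show False using proper_neq[OF C e(1), of f x] f x e(2) c by auto
  qed
  with c show ?thesis by simp
qed

lemma spine_alternating:
  assumes C: "proper_edge_coloring \<Delta> E C" and V: "reserved \<Delta> C V M"
    and xs: "distinct xs" "set xs \<subseteq> V" "successively (\<lambda>x y. {x, y} \<in> E) xs"
  shows "alternating (Some ` M) (\<lambda>i. C (link xs i)) (length xs - 1)"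
  unfolding alternating_def
proof (intro conjI allI impI)
  have E: "link xs i \<in> E" if "Suc i < length xs" for i
    using successively_nth[OF xs(3) that] by (simp add: link_def)
  fix i
  show "C (link xs i) \<in> Some ` M" if "i < length xs - 1"
  proof (rule reserved_edge_color[OF C V E])
    show "Suc i < length xs" "link xs i \<noteq> {}" using that by (auto simp: link_def)
    have "xs ! i \<in> set xs" "xs ! Suc i \<in> set xs" using that by auto
    then show "link xs i \<subseteq> V" using xs(2) by (auto simp: link_def)
  qed
  show "C (link xs i) \<noteq> C (link xs (Suc i))" if i: "Suc i < length xs - 1"
  proof (rule proper_neq[OF C E E])
    show "link xs i \<noteq> link xs (Suc i)"
      using inj_on_contraD[OF inj_on_link[OF xs(1)], of i "Suc i"] i by simp
    show "xs ! Suc i \<in> link xs i" "xs ! Suc i \<in> link xs (Suc i)" by (auto simp: link_def)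
  qed (use i in auto)
qed

lemma recourse_ge_links:
  assumes "finite (dom C)" "distinct xs" "I \<subseteq> {..<length xs - 1}"
    and "\<And>i. i \<in> I \<Longrightarrow> link xs i \<in> dom C \<and> C' (link xs i) \<noteq> C (link xs i)"
  shows "card I \<le> recourse C C'"
proof -
  have "card I = card (link xs ` I)"
    using inj_on_subset[OF inj_on_link[OF assms(2)] assms(3)] by (simp add: card_image)
  also have "\<dots> \<le> recourse C C'"
    unfolding recourse_def by (rule card_mono) (use assms(1,4) in auto)
  finally show ?thesis .
qed

text \<open>
  After the insertion the two links next to the new one have the same color, so if they differed
  before, one of the two alternating colorings has been swapped entirely.
\<close>

lemma join_recourse:
  assumes C: "proper_edge_coloring \<Delta> E C" "reserved \<Delta> C V M"
    and C': "proper_edge_coloring \<Delta> (insert {last ps, hd qs} E) C'" "reserved \<Delta> C' V M"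
    and M: "card M = 2" and fin: "finite E"
    and dist: "distinct (ps @ qs)" and V: "set (ps @ qs) \<subseteq> V"
    and ps: "successively (\<lambda>x y. {x, y} \<in> E) ps" and qs: "successively (\<lambda>x y. {x, y} \<in> E) qs"
    and len: "length ps = L" "length qs = L" "2 \<le> L"
    and conflict: "C (link ps (L - 2)) \<noteq> C (link qs 0)"
  shows "L - 1 \<le> recourse C C'"
proof -
  define M' where "M' = Some ` M"
  have M': "card M' = 2" using M by (simp add: M'_def card_image)
  let ?E = "insert {last ps, hd qs} E"
  have all: "successively (\<lambda>x y. {x, y} \<in> ?E) (ps @ qs)"
    using ps qs by (auto simp: successively_append_iff elim: successively_mono)
  have a: "alternating M' (\<lambda>i. C (link ps i)) (L - 1)"
    using spine_alternating[OF C _ _ ps] dist V len by (simp add: M'_def)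
  have b: "alternating M' (\<lambda>i. C (link qs i)) (L - 1)"
    using spine_alternating[OF C _ _ qs] dist V len by (simp add: M'_def)
  have z: "alternating M' (\<lambda>i. C' (link (ps @ qs) i)) (2 * L - 1)"
    using spine_alternating[OF C' dist V all] len by (simp add: M'_def mult_2)
  have a': "alternating M' (\<lambda>i. C' (link ps i)) (L - 1)"
    using spine_alternating[OF C', of ps] all dist V len
    by (simp add: M'_def successively_append_iff)
  have b': "alternating M' (\<lambda>i. C' (link qs i)) (L - 1)"
    using spine_alternating[OF C', of qs] all dist V len
    by (simp add: M'_def successively_append_iff)
  \<comment> \<open>In the joined path the new link has position \<open>L - 1\<close>, and the first
    link of \<open>qs\<close> has position \<open>L\<close>. Positions \<open>L - 2\<close> and
    \<open>L\<close> have equal parity, hence equal colors.\<close>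
  have "C' (link ps (L - 2)) = C' (link qs 0)"
  proof -
    have "C' (link (ps @ qs) (L - 2)) = C' (link (ps @ qs) 0) \<longleftrightarrow> even (L - 2)"
      "C' (link (ps @ qs) L) = C' (link (ps @ qs) 0) \<longleftrightarrow> even L"
      using alternating_parity[OF M' z, of "L - 2"] alternating_parity[OF M' z, of L] len(3)
      by simp_all
    moreover have "C' (link (ps @ qs) (L - 2)) \<in> M'" "C' (link (ps @ qs) L) \<in> M'"
      "C' (link (ps @ qs) 0) \<in> M'"
      using z len(3) by (simp_all add: alternating_def)
    moreover obtain x y where xy: "M' = {x, y}" using M' by (auto simp: card_2_iff)
    moreover have "even (L - 2) \<longleftrightarrow> even L" using len(3) by simp
    ultimately have "C' (link (ps @ qs) (L - 2)) = C' (link (ps @ qs) L)"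
      unfolding xy by (metis empty_iff insert_iff)
    then show ?thesis
      using len link_append1[of "L - 2" ps qs] link_append2[of ps qs 0] by simp
  qed
  with conflict consider "C' (link ps (L - 2)) \<noteq> C (link ps (L - 2))"
    | "C' (link qs 0) \<noteq> C (link qs 0)" by metis
  then show ?thesis
  proof cases
    case 1
    have "card {..<L - 1} \<le> recourse C C'"
    proof (rule recourse_ge_links[of C ps])
      fix i assume i: "i \<in> {..<L - 1}"
      have "L - 2 < L - 1" using len by simp
      then have "C' (link ps i) \<noteq> C (link ps i)"
        using alternating_eq_iff[OF M' a' a, of i] alternating_eq_iff[OF M' a' a, of "L - 2"] 1 i
        by simp
      moreover have "link ps i \<in> E"
        using successively_nth[OF ps] i len by (simp add: link_def)
      ultimately show "link ps i \<in> dom C \<and> C' (link ps i) \<noteq> C (link ps i)"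
        using proper_dom[OF C(1)] by simp
    qed (use dist len fin proper_dom[OF C(1)] in auto)
    then show ?thesis by simp
  next
    case 2
    have "card {..<L - 1} \<le> recourse C C'"
    proof (rule recourse_ge_links[of C qs])
      fix i assume i: "i \<in> {..<L - 1}"
      have "C' (link qs i) \<noteq> C (link qs i)"
        using alternating_eq_iff[OF M' b' b, of i] 2 i by simp
      moreover have "link qs i \<in> E"
        using successively_nth[OF qs] i len by (simp add: link_def)
      ultimately show "link qs i \<in> dom C \<and> C' (link qs i) \<noteq> C (link qs i)"
        using proper_dom[OF C(1)] by simp
    qed (use dist len fin proper_dom[OF C(1)] in auto)
    then show ?thesis by simp
  qed
qed

text \<open>A path whose two ends can each take a further edge. A single vertex needs room for two,
  because after one join it is still an end. The set \<open>S\<close> stands for the components of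
  the path, star leaves included; requiring only its trace on \<open>V\<close> avoids naming the
  leaves.\<close>

definition spine :: "nat \<Rightarrow> nat set \<Rightarrow> edge set \<Rightarrow> nat list \<Rightarrow> bool" where
  "spine \<Delta> V E xs \<longleftrightarrow>
     xs \<noteq> [] \<and> distinct xs \<and> successively (\<lambda>x y. {x, y} \<in> E) xs \<and>
     degree E (hd xs) < \<Delta> \<and> degree E (last xs) < \<Delta> \<and>
     (length xs = 1 \<longrightarrow> Suc (degree E (hd xs)) < \<Delta>) \<and>
     (\<exists>S. S \<inter> V = set xs \<and> closed_under E S)"

lemma spine_rev: "spine \<Delta> V E xs \<Longrightarrow> spine \<Delta> V E (rev xs)"
proof -
  assume "spine \<Delta> V E xs"
  moreover have "hd xs = last xs" if "length xs = 1"
    using that by (cases xs) auto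
  ultimately show ?thesis
    unfolding spine_def by (auto simp: hd_rev last_rev insert_commute)
qed

lemma closed_under_Un_untouched:
  assumes "closed_under E S" "\<forall>e\<in>F. e \<inter> S = {}"
  shows "closed_under (E \<union> F) S"
  using assms unfolding closed_under_def by blast

text \<open>New edges inside \<open>V\<close> that avoid the path also avoid \<open>S\<close>, since
  \<open>S\<close> meets \<open>V\<close> only in the path. This lets one part of a group wait while
  another is processed.\<close>

lemma spine_untouched:
  assumes xs: "spine \<Delta> V E xs" and F: "\<forall>e\<in>F. e \<subseteq> V - set xs"
  shows "spine \<Delta> V (E \<union> F) xs"
proof -
  have deg: "degree (E \<union> F) x = degree E x" if "x \<in> set xs" for x
    by (rule degree_untouched) (use F that in blast)
  obtain S where S: "S \<inter> V = set xs" "closed_under E S" using xs unfolding spine_def by blast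
  have "closed_under (E \<union> F) S"
    by (rule closed_under_Un_untouched[OF S(2)]) (use F S(1) in blast)
  moreover have "successively (\<lambda>x y. {x, y} \<in> E \<union> F) xs"
    using xs unfolding spine_def by (auto elim: successively_mono)
  ultimately show ?thesis
    using xs deg S(1) unfolding spine_def by (metis hd_in_set last_in_set)
qed

lemma spine_join:
  assumes ps: "spine \<Delta> V E ps" and qs: "spine \<Delta> V E qs" and disj: "set ps \<inter> set qs = {}"
    and fin: "finite E"
  shows "spine \<Delta> V (insert {last ps, hd qs} E) (ps @ qs)"
proof -
  let ?e = "{last ps, hd qs}"
  have ne: "ps \<noteq> []" "qs \<noteq> []" using ps qs unfolding spine_def by auto
  have p: "degree (insert ?e E) (hd ps) < \<Delta>"
  \<comment> \<open>The far end \<open>hd ps\<close> gains the new edge only when it coincides with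
    \<open>last ps\<close>; that is the case for which single vertices carry the stronger degree
    bound.\<close>
  proof (cases "length ps = 1")
    case True
    then show ?thesis using ps degree_insert_le[OF fin, of ?e "hd ps"] unfolding spine_def
      by (auto split: if_splits)
  next
    case False
    then have "hd ps \<noteq> last ps" using ps unfolding spine_def
      by (cases ps) (auto split: if_splits)
    moreover have "hd ps \<noteq> hd qs" using disj ne by (metis disjoint_iff hd_in_set)
    ultimately show ?thesis using ps degree_insert_le[OF fin, of ?e "hd ps"] unfolding spine_def
      by auto
  qed
  have q: "degree (insert ?e E) (last qs) < \<Delta>"
  proof (cases "length qs = 1")
    case True
    then have "last qs = hd qs" by (cases qs) auto
    then show ?thesis using True qs degree_insert_le[OF fin, of ?e "last qs"] unfolding spine_def
      by (auto split: if_splits)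
  next
    case False
    then have "last qs \<noteq> hd qs" using qs unfolding spine_def
      by (cases qs) (auto split: if_splits)
    moreover have "last qs \<noteq> last ps" using disj ne by (metis disjoint_iff last_in_set)
    ultimately show ?thesis using qs degree_insert_le[OF fin, of ?e "last qs"] unfolding spine_def
      by auto
  qed
  obtain S where S: "S \<inter> V = set ps" "closed_under E S" using ps unfolding spine_def by blast
  obtain T where T: "T \<inter> V = set qs" "closed_under E T" using qs unfolding spine_def by blast
  have "last ps \<in> S" "hd qs \<in> T" using S(1) T(1) ne hd_in_set last_in_set by blast+
  then have "closed_under (insert ?e E) (S \<union> T)"
    using S(2) T(2) unfolding closed_under_def by blast
  moreover have "(S \<union> T) \<inter> V = set (ps @ qs)" using S(1) T(1) by auto
  moreover have "length (ps @ qs) \<noteq> 1" using ne by (cases ps; cases qs) auto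
  moreover have "successively (\<lambda>x y. {x, y} \<in> insert ?e E) (ps @ qs)"
    using ps qs unfolding spine_def
    by (auto simp: successively_append_iff elim: successively_mono)
  ultimately show ?thesis
    using p q ps qs disj ne unfolding spine_def by (auto simp: hd_append last_append)
qed

section \<open>Building stars\<close>

lemma add_star:
  assumes "insertion_sequence n \<Delta> es" "finite L" "u < n" "L \<subseteq> {..<n}" "u \<notin> L" "card L \<le> \<Delta>"
    and "\<forall>e\<in>set es. e \<inter> insert u L = {}"
  shows "\<exists>ext. insertion_sequence n \<Delta> (es @ ext) \<and> set ext = (\<lambda>v. {u, v}) ` L \<and> length ext = card L"
  using assms(2,1,3-)
proof (induction L rule: finite_induct)
  case empty
  then show ?case by (intro exI[of _ "[]"]) simp
next
  case (insert v L)
  then obtain ext where ext: "insertion_sequence n \<Delta> (es @ ext)"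
    "set ext = (\<lambda>v. {u, v}) ` L" "length ext = card L" by auto
  have v: "\<forall>e\<in>set (es @ ext). v \<notin> e" using insert ext(2) by auto
  have "degree (set (es @ ext)) v = 0"
  proof -
    have "{e \<in> set (es @ ext). v \<in> e} = {}" using v by blast
    then show ?thesis by (simp only: degree_def card.empty)
  qed
  moreover have "degree (set (es @ ext)) u < \<Delta>"
  proof -
    have "{e \<in> set (es @ ext). u \<in> e} = (\<lambda>v. {u, v}) ` L" using insert.prems ext(2) by auto
    then have "degree (set (es @ ext)) u \<le> card L"
      using card_image_le[OF insert.hyps(1)] by (simp add: degree_def)
    also have "\<dots> < \<Delta>" using insert by simp
    finally show ?thesis .
  qed
  \<comment> \<open>The new leaf is still isolated, so \<open>{v}\<close> separates it from the
    center; this is why the edge is inserted as \<open>{v, u}\<close>.\<close>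
  moreover have "closed_under (set (es @ ext)) {v}" using v by (auto simp: closed_under_def)
  ultimately have "insertion_sequence n \<Delta> ((es @ ext) @ [{v, u}])"
    using insert.prems by (intro insertion_sequence_snoc[OF ext(1)]) auto
  then show ?case using ext insert.hyps
    by (intro exI[of _ "ext @ [{v, u}]"]) (auto simp: insert_commute)
qed

lemma add_stars:
  assumes "finite B"
    and "\<And>b. b \<in> B \<Longrightarrow> b < n \<and> finite (L b) \<and> L b \<subseteq> {..<n} \<and> b \<notin> L b \<and> card (L b) \<le> \<Delta>"
    and "disjoint_family_on (\<lambda>b. insert b (L b)) B"
  shows "\<exists>es. insertion_sequence n \<Delta> es \<and> set es = (\<Union>b\<in>B. (\<lambda>v. {b, v}) ` L b) \<and>
    length es = (\<Sum>b\<in>B. card (L b))"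
  using assms
proof (induction B rule: finite_induct)
  case empty
  then show ?case by (intro exI[of _ "[]"]) (simp add: insertion_sequence.empty)
next
  case (insert b B)
  have "disjoint_family_on (\<lambda>b. insert b (L b)) B"
    using insert.prems(2) by (rule disjoint_family_on_mono[rotated]) auto
  then obtain es where es: "insertion_sequence n \<Delta> es" "set es = (\<Union>b\<in>B. (\<lambda>v. {b, v}) ` L b)"
    "length es = (\<Sum>b\<in>B. card (L b))"
    using insert by auto
  have "insert c (L c) \<inter> insert b (L b) = {}" if "c \<in> B" for c
    using insert.prems(2) insert.hyps(2) that by (auto simp: disjoint_family_on_def)
  then have "\<forall>e\<in>set es. e \<inter> insert b (L b) = {}" unfolding es(2) by blast
  then obtain ext where "insertion_sequence n \<Delta> (es @ ext)"
    "set ext = (\<lambda>v. {b, v}) ` L b" "length ext = card (L b)"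
    using add_star[OF es(1), of "L b" b] insert.prems(1) by auto
  then show ?case using es insert.hyps by (intro exI[of _ "es @ ext"]) auto
qed

lemma insertion_sequence_new:
  assumes "insertion_sequence n \<Delta> (es @ [e])"
  shows "e \<notin> set es"
proof
  assume e: "e \<in> set es"
  from assms obtain u v where "e = {u, v}" "(u, v) \<notin> (adjacency (set es))\<^sup>*"
    by (cases rule: insertion_sequence.cases) auto
  then show False using e by (auto simp: adjacency_def)
qed

lemma recourse_0:
  assumes "recourse C C' = 0" "finite (dom C)" "C e = Some c"
  shows "C' e = Some c"
proof -
  have "{e \<in> dom C. C' e \<noteq> C e} = {}" using assms(1,2) by (simp add: recourse_def)
  moreover have "e \<in> dom C" using assms(3) by blast
  ultimately have "C' e = C e" by blast
  then show ?thesis using assms(3) by simp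
qed

lemma pigeonhole_fiber:
  assumes "finite T" "f ` R \<subseteq> T" "card T * m < card R"
  shows "\<exists>t\<in>T. m < card {x \<in> R. f x = t}"
proof (rule ccontr)
  assume "\<not> ?thesis"
  then have le: "card {x \<in> R. f x = t} \<le> m" if "t \<in> T" for t using that by (simp add: not_less)
  have "R = (\<Union>t\<in>T. {x \<in> R. f x = t})" using assms(2) by auto
  then have "card R \<le> (\<Sum>t\<in>T. card {x \<in> R. f x = t})"
    using card_UN_le[OF assms(1)] by metis
  also have "\<dots> \<le> card T * m" using sum_bounded_above[of T _ m] le by simp
  finally show False using assms(3) by simp
qed

section \<open>Recourse of shift-based algorithms\<close>

locale shift_algorithm =
  fixes n \<Delta> :: nat and A :: algorithm
  assumes proper: "maintains_proper_coloring n \<Delta> A"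
    and shifts: "shift_based n \<Delta> A"
begin

lemma proper_coloring:
  "insertion_sequence n \<Delta> es \<Longrightarrow> proper_edge_coloring \<Delta> (set es) (A es)"
  using proper by (simp add: maintains_proper_coloring_def)

definition ready :: "nat set \<Rightarrow> nat set \<Rightarrow> edge list \<Rightarrow> bool" where
  "ready V M es \<longleftrightarrow> insertion_sequence n \<Delta> es \<and> reserved \<Delta> (A es) V M"

text \<open>This is where being shift-based enters: the new edge lies inside \<open>V\<close>, so
  its shift chain leaves the edges not contained in \<open>V\<close> unchanged, and \<open>M\<close>
  stays reserved.\<close>

lemma ready_join:
  assumes V: "V \<subseteq> {..<n}" and es: "ready V M es"
    and ps: "spine \<Delta> V (set es) ps" and qs: "spine \<Delta> V (set es) qs"
    and disj: "set ps \<inter> set qs = {}"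
  shows "ready V M (es @ [{last ps, hd qs}])"
proof -
  have ne: "ps \<noteq> []" "qs \<noteq> []" using ps qs unfolding spine_def by auto
  obtain S where S: "S \<inter> V = set ps" "closed_under (set es) S" using ps unfolding spine_def by blast
  obtain T where T: "T \<inter> V = set qs" using qs unfolding spine_def by blast
  have mem: "last ps \<in> set ps" "hd qs \<in> set qs" using ne by auto
  then have inV: "last ps \<in> V" "hd qs \<in> V" using S T by auto
  have seq: "insertion_sequence n \<Delta> (es @ [{last ps, hd qs}])"
  proof (rule insertion_sequence_snoc[OF _ _ _ S(2)])
    show "hd qs \<notin> S" using S(1) mem disj inV by blast
  qed (use es inV V S(1) mem ps qs in \<open>auto simp: ready_def spine_def\<close>)
  then have chain: "shift_chain \<Delta> (A es) {last ps, hd qs} (A (es @ [{last ps, hd qs}]))"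
    using shifts by (simp add: shift_based_def)
  have "reserved \<Delta> (A (es @ [{last ps, hd qs}])) V M"
    by (rule reserved_cong[OF _ shift_chain_reserved[OF chain]])
      (use es inV in \<open>auto simp: ready_def\<close>)
  with seq show ?thesis by (simp add: ready_def)
qed

text \<open>An odd number of vertices means an even number of links, so the first and last links
  have different colors. At most one of them is \<open>c\<close>, and reversal brings the other to
  the front.\<close>

lemma orient_conflict:
  assumes V: "ready V M es" and M: "card M = 2" and qs: "spine \<Delta> V (set es) qs" "set qs \<subseteq> V"
    and len: "odd (length qs)" "2 \<le> length qs"
  shows "\<exists>qs' \<in> {qs, rev qs}. A es (link qs' 0) \<noteq> c"
proof -
  have "insertion_sequence n \<Delta> es" "reserved \<Delta> (A es) V M" using V by (auto simp: ready_def)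
  then have alt: "alternating (Some ` M) (\<lambda>i. A es (link qs i)) (length qs - 1)"
    using spine_alternating[OF proper_coloring] qs by (simp add: spine_def)
  have "card (Some ` M) = 2" using M by (simp add: card_image)
  from alternating_parity[OF this alt, of "length qs - 2"]
  have "A es (link qs (length qs - 2)) \<noteq> A es (link qs 0)" using len by simp
  moreover have "link (rev qs) 0 = link qs (length qs - 2)" using link_rev[of 0 qs] len by simp
  ultimately show ?thesis by force
qed

lemma merge:
  assumes V: "V \<subseteq> {..<n}" and M: "card M = 2" and es: "ready V M es"
    and ps: "spine \<Delta> V (set es) ps" "set ps \<subseteq> V" and qs: "spine \<Delta> V (set es) qs" "set qs \<subseteq> V"
    and disj: "set ps \<inter> set qs = {}" and len: "length ps = L" "length qs = L" "odd L"
  shows "\<exists>e xs. ready V M (es @ [e]) \<and> spine \<Delta> V (set (es @ [e])) xs \<and>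
    set xs = set ps \<union> set qs \<and> e \<subseteq> set ps \<union> set qs \<and>
    total_recourse A es + (L - 1) \<le> total_recourse A (es @ [e])"
proof -
  \<comment> \<open>For \<open>L = 1\<close> there are no links to compare, and the cost
    \<open>L - 1\<close> to be shown is zero.\<close>
  have "\<exists>qs' \<in> {qs, rev qs}. 2 \<le> L \<longrightarrow> A es (link ps (L - 2)) \<noteq> A es (link qs' 0)"
  proof (cases "2 \<le> L")
    case True
    then show ?thesis
      using orient_conflict[OF es M qs, of "A es (link ps (L - 2))"] len by metis
  qed auto
  then obtain qs' where qs': "qs' = qs \<or> qs' = rev qs"
    and conflict: "2 \<le> L \<Longrightarrow> A es (link ps (L - 2)) \<noteq> A es (link qs' 0)" by blast
  have sp: "spine \<Delta> V (set es) qs'" and set: "set qs' = set qs" and len': "length qs' = L"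
    using qs' qs(1) spine_rev len by auto
  define e where "e = {last ps, hd qs'}"
  have r: "ready V M (es @ [e])"
    unfolding e_def using ready_join[OF V es ps(1) sp] disj set by simp
  have s: "spine \<Delta> V (set (es @ [e])) (ps @ qs')"
    using spine_join[OF ps(1) sp] disj set by (simp add: e_def)
  have "L - 1 \<le> recourse (A es) (A (es @ [e]))"
  proof (cases "2 \<le> L")
    case True
    show ?thesis
    proof (rule join_recourse[OF proper_coloring _ _ _ M])
      show "proper_edge_coloring \<Delta> (insert {last ps, hd qs'} (set es)) (A (es @ [e]))"
        using proper_coloring[of "es @ [e]"] r by (simp add: ready_def e_def)
    qed (use es r conflict True ps qs len len' sp set disj in \<open>auto simp: ready_def spine_def\<close>)
  qed simp
  then have "total_recourse A es + (L - 1) \<le> total_recourse A (es @ [e])"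
    by (simp add: total_recourse_snoc)
  moreover have "e \<subseteq> set ps \<union> set qs"
    using ps(1) sp set hd_in_set[of qs'] by (auto simp: e_def spine_def)
  ultimately show ?thesis using r s set by (intro exI[of _ e] exI[of _ "ps @ qs'"]) auto
qed

text \<open>The cost satisfies T(0) = 0 and T(k + 1) = 2 T(k) + (s - 1) with s =
  \<open>2 ^ Suc k - 1\<close>, the number of vertices in each of two merged paths. The solution is
  \<open>k * 2 ^ k + 2 - 2 ^ Suc k\<close>; its negative term stands on the other side to avoid
  truncated subtraction.\<close>

lemma build_spine:
  assumes V: "V \<subseteq> {..<n}" and M: "card M = 2"
    and "ready V M es" "W \<subseteq> V" "card W = 2 ^ Suc k - 1"
    and "\<And>w. w \<in> W \<Longrightarrow> spine \<Delta> V (set es) [w]"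
  shows "\<exists>ext xs. ready V M (es @ ext) \<and> spine \<Delta> V (set (es @ ext)) xs \<and> set xs = W \<and>
    (\<forall>e\<in>set ext. e \<subseteq> W) \<and> Suc (length ext) \<le> card W \<and>
    total_recourse A es + k * 2 ^ k + 2 \<le> total_recourse A (es @ ext) + 2 ^ Suc k"
  using assms(3-)
proof (induction k arbitrary: es W)
  case 0
  then obtain w where "W = {w}" by (auto simp: card_1_singleton_iff)
  with 0 show ?case by (intro exI[of _ "[]"] exI[of _ "[w]"]) auto
next
  case (Suc k)
  define s :: nat where "s = 2 ^ Suc k - 1"
  have s: "Suc s = 2 ^ Suc k" and card: "card W = Suc (s + s)" and "odd s"
  proof -
    have "1 \<le> (2::nat) ^ k" by simp
    then show "Suc s = 2 ^ Suc k" by (simp add: s_def)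
    then show "card W = Suc (s + s)" using Suc.prems(3) by simp
    show "odd s" by (simp add: s_def)
  qed
  have finW: "finite W" using card by (simp add: card_ge_0_finite)
  \<comment> \<open>Split \<open>W\<close> into two halves of size \<open>s\<close> and one spare
    vertex \<open>w\<close>. Merging the halves gives the even number \<open>2 * s\<close> of
    vertices, and appending \<open>w\<close> makes it odd again.\<close>
  obtain W1 where W1: "W1 \<subseteq> W" "card W1 = s"
    using obtain_subset_with_card_n[of s W] card by auto
  then have "card (W - W1) = Suc s" using card finW by (simp add: card_Diff_subset finite_subset)
  then have "W - W1 \<noteq> {}" by force
  then obtain w where w: "w \<in> W - W1" by blast
  define W2 where "W2 = W - W1 - {w}"
  have cW2: "card W2 = s" using \<open>card (W - W1) = Suc s\<close> w finW by (simp add: W2_def)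
  have W: "W = W1 \<union> W2 \<union> {w}" "W1 \<inter> W2 = {}" "w \<notin> W1" "w \<notin> W2"
    using W1 w by (auto simp: W2_def)
  obtain ext1 ps where 1: "ready V M (es @ ext1)" "spine \<Delta> V (set (es @ ext1)) ps" "set ps = W1"
    "\<forall>e\<in>set ext1. e \<subseteq> W1" "Suc (length ext1) \<le> s"
    "total_recourse A es + k * 2 ^ k + 2 \<le> total_recourse A (es @ ext1) + 2 ^ Suc k"
    using Suc.IH[OF Suc.prems(1), of W1] Suc.prems(2,4) W W1 s_def by auto
  define es1 where "es1 = es @ ext1"
  \<comment> \<open>The first half used only edges inside \<open>W1\<close>, so the remaining
    vertices are still one-vertex spines for the second application of the induction
    hypothesis.\<close>
  have single1: "spine \<Delta> V (set es1) [x]" if "x \<in> W2 \<union> {w}" for x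
    unfolding es1_def set_append
    by (rule spine_untouched) (use that 1(4) W Suc.prems(2,4) in \<open>auto 4 4\<close>)
  obtain ext2 qs where 2: "ready V M (es1 @ ext2)" "spine \<Delta> V (set (es1 @ ext2)) qs" "set qs = W2"
    "\<forall>e\<in>set ext2. e \<subseteq> W2" "Suc (length ext2) \<le> s"
    "total_recourse A es1 + k * 2 ^ k + 2 \<le> total_recourse A (es1 @ ext2) + 2 ^ Suc k"
    using Suc.IH[of es1 W2] Suc.prems(2) W cW2 s_def 1(1) single1 unfolding es1_def by auto
  define es2 where "es2 = es1 @ ext2"
  have ps2: "spine \<Delta> V (set es2) ps"
    unfolding es2_def set_append
  proof (rule spine_untouched)
    show "spine \<Delta> V (set es1) ps" using 1(2) by (simp add: es1_def)
    show "\<forall>e\<in>set ext2. e \<subseteq> V - set ps" using 1(3) 2(4) W(1,2) Suc.prems(2) by blast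
  qed
  have w2: "spine \<Delta> V (set es2) [w]"
    unfolding es2_def set_append
  proof (rule spine_untouched)
    show "spine \<Delta> V (set es1) [w]" using single1 by simp
    show "\<forall>e\<in>set ext2. e \<subseteq> V - set [w]" using 2(4) W(1,4) Suc.prems(2) by auto
  qed
  have len: "length ps = s" "length qs = s"
    using 1(2,3) 2(2,3) W1(2) cW2 by (auto simp: spine_def distinct_card[symmetric])
  have sub: "set ps \<subseteq> V" "set qs \<subseteq> V" "set ps \<inter> set qs = {}" using 1(3) 2(3) W Suc.prems(2) by auto
  obtain e xs where 3: "ready V M (es2 @ [e])" "spine \<Delta> V (set (es2 @ [e])) xs"
    "set xs = set ps \<union> set qs" "e \<subseteq> set ps \<union> set qs"
    "total_recourse A es2 + (s - 1) \<le> total_recourse A (es2 @ [e])"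
    using merge[OF V M _ ps2 sub(1) _ sub(2,3) len \<open>odd s\<close>] 2(1,2) unfolding es2_def by metis
  define es3 where "es3 = es2 @ [e]"
  have w3: "spine \<Delta> V (set es3) [w]"
    unfolding es3_def set_append
    by (rule spine_untouched[OF w2]) (use 3(4) 1(3) 2(3) W Suc.prems(2) in auto)
  have disj: "set xs \<inter> set [w] = {}" using 3(3) 1(3) 2(3) W by auto
  define f where "f = {last xs, hd [w]}"
  have xs3: "spine \<Delta> V (set es3) xs" using 3(2) by (simp add: es3_def)
  have r4: "ready V M (es3 @ [f])"
    unfolding f_def by (rule ready_join[OF V _ xs3 w3 disj]) (use 3(1) es3_def in simp)
  have s4: "spine \<Delta> V (set (es3 @ [f])) (xs @ [w])"
    using spine_join[OF xs3 w3 disj] by (simp add: f_def)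
  \<comment> \<open>No cost is claimed for appending the spare vertex.\<close>
  have t4: "total_recourse A es3 \<le> total_recourse A (es3 @ [f])" by (rule total_recourse_mono)
  define ext where "ext = ext1 @ ext2 @ [e, f]"
  have eq: "es @ ext = es3 @ [f]" by (simp add: ext_def es3_def es2_def es1_def)
  have "last xs \<in> W" using xs3 3(3) 1(3) 2(3) W last_in_set[of xs] by (auto simp: spine_def)
  then have "\<forall>e\<in>set ext. e \<subseteq> W"
    using 1(3,4) 2(3,4) 3(4) W by (auto simp: ext_def f_def)
  moreover have "set (xs @ [w]) = W" using 3(3) 1(3) 2(3) W by auto
  moreover have "Suc (length ext) \<le> card W" using 1(5) 2(5) card by (simp add: ext_def)
  moreover have "total_recourse A es + Suc k * 2 ^ Suc k + 2 \<le> total_recourse A (es @ ext) + 2 ^ Suc (Suc k)"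
  proof -
    \<comment> \<open>This makes the subtraction in \<open>s - 1\<close> exact, so that the
      recurrence can be solved by arithmetic.\<close>
    have "1 \<le> s" using \<open>odd s\<close> by (cases s) auto
    then show ?thesis using 1(6) 2(6) 3(5) t4 s unfolding eq es1_def es2_def es3_def
      by (simp add: algebra_simps)
  qed
  ultimately show ?case using r4 s4 eq by metis
qed

text \<open>At zero recourse every old edge keeps its color, so properness forces the new edge to
  take a color missing at both of its endpoints.\<close>

lemma free_insertion:
  assumes es: "insertion_sequence n \<Delta> (es @ [e])" and 0: "recourse (A es) (A (es @ [e])) = 0"
  shows "\<exists>c. A (es @ [e]) e = Some c \<and> (\<forall>u\<in>e. c \<in> {1..\<Delta>} - used (A es) u)"
    and "used (A es) u \<subseteq> used (A (es @ [e])) u"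
proof -
  have C: "proper_edge_coloring \<Delta> (set es) (A es)"
    using proper_coloring[OF insertion_sequence_prefix[OF es]] .
  have C': "proper_edge_coloring \<Delta> (insert e (set es)) (A (es @ [e]))"
    using proper_coloring[OF es] by simp
  have fin: "finite (dom (A es))" using proper_dom[OF C] by simp
  note keep = recourse_0[OF 0 fin]
  show "used (A es) u \<subseteq> used (A (es @ [e])) u" using keep unfolding used_def by blast
  obtain c where c: "A (es @ [e]) e = Some c" using proper_dom[OF C'] by blast
  have "c \<notin> used (A es) u" if u: "u \<in> e" for u
  proof
    assume "c \<in> used (A es) u"
    then obtain f where f: "u \<in> f" "A es f = Some c" unfolding used_def by blast
    then have "f \<in> set es" using proper_dom[OF C] by blast
    moreover have "e \<noteq> f" using insertion_sequence_new[OF es] \<open>f \<in> set es\<close> by blast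
    ultimately have "A (es @ [e]) e \<noteq> A (es @ [e]) f"
      using proper_neq[OF C', of e f u] u f by blast
    then show False using c keep[OF f(2)] by simp
  qed
  with c show "\<exists>c. A (es @ [e]) e = Some c \<and> (\<forall>u\<in>e. c \<in> {1..\<Delta>} - used (A es) u)"
    using proper_range[OF C' c] by blast
qed

end

section \<open>Disjoint stars and groups of centers with a common missing pair\<close>

locale stars = shift_algorithm +
  fixes B :: "nat set" and L :: "nat \<Rightarrow> nat set" and d :: nat and es0 :: "edge list"
  assumes centers: "B \<subseteq> {..<n}"
    and leaves: "\<And>b. b \<in> B \<Longrightarrow> card (L b) = d \<and> b \<notin> L b"
    and disjoint: "disjoint_family_on (\<lambda>b. insert b (L b)) B"
    and seq0: "insertion_sequence n \<Delta> es0"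
    and set0: "set es0 = (\<Union>b\<in>B. (\<lambda>v. {b, v}) ` L b)"
begin

lemma finite_centers: "finite B"
  using centers finite_subset by blast

lemma leaf_not_center: "b \<in> B \<Longrightarrow> v \<in> L b \<Longrightarrow> v \<notin> B"
  using disjoint leaves[of b] unfolding disjoint_family_on_def by (metis IntI empty_iff insertCI)

lemma leaf_unique: "b \<in> B \<Longrightarrow> c \<in> B \<Longrightarrow> v \<in> L b \<Longrightarrow> v \<in> L c \<Longrightarrow> b = c"
  using disjoint unfolding disjoint_family_on_def by (metis IntI empty_iff insertCI)

text \<open>\<open>U\<close> collects the centers processed so far. Later edges stay inside
  \<open>U\<close>, so around any other center the forest still looks as it did initially.\<close>

lemma fresh_star:
  assumes ext: "\<forall>e\<in>set ext. e \<subseteq> U" and U: "U \<subseteq> B" and x: "x \<in> B - U"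
  shows "{e \<in> set (es0 @ ext). x \<in> e} = (\<lambda>v. {x, v}) ` L x"
    and "degree (set (es0 @ ext)) x = d"
    and "closed_under (set (es0 @ ext)) (insert x (L x))"
proof -
  show 1: "{e \<in> set (es0 @ ext). x \<in> e} = (\<lambda>v. {x, v}) ` L x"
  proof
    show "{e \<in> set (es0 @ ext). x \<in> e} \<subseteq> (\<lambda>v. {x, v}) ` L x"
    proof
      fix e assume e: "e \<in> {e \<in> set (es0 @ ext). x \<in> e}"
      then have "e \<in> set es0" using ext x by auto
      then obtain b v where b: "b \<in> B" "v \<in> L b" "e = {b, v}" unfolding set0 by blast
      then have "x = b" using e x leaf_not_center by blast
      then show "e \<in> (\<lambda>v. {x, v}) ` L x" using b by blast
    qed
    show "(\<lambda>v. {x, v}) ` L x \<subseteq> {e \<in> set (es0 @ ext). x \<in> e}" using x set0 by auto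
  qed
  have "inj_on (\<lambda>v. {x, v}) (L x)" by (auto simp: inj_on_def doubleton_eq_iff)
  then show "degree (set (es0 @ ext)) x = d"
    unfolding degree_def 1 using leaves x by (simp add: card_image)
  show "closed_under (set (es0 @ ext)) (insert x (L x))"
    unfolding closed_under_def
  proof (intro ballI impI)
    fix e assume e: "e \<in> set (es0 @ ext)" "e \<inter> insert x (L x) \<noteq> {}"
    have "U \<inter> insert x (L x) = {}" using U x leaf_not_center by blast
    then have "e \<notin> set ext" using ext e(2) by blast
    then obtain b v where b: "b \<in> B" "v \<in> L b" "e = {b, v}" using e(1) set0 by auto
    have "b = x"
      using e(2) b x leaf_not_center[of x b] leaf_not_center[of b x] leaf_unique[of b x v] by blast
    then show "e \<subseteq> insert x (L x)" using b by blast
  qed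
qed

text \<open>Each unprocessed center sees \<open>\<Delta> - 2\<close> distinct colors and so misses a
  pair. There are at most \<open>\<Delta>\<^sup>2\<close> pairs, hence some \<open>g\<close> centers
  share one. All their edges go to leaves, which lie outside \<open>V\<close>, so the shared pair is
  reserved.\<close>

lemma uniform_group:
  assumes degree_ge: "2 \<le> \<Delta>" and d: "d = \<Delta> - 2"
    and seq: "insertion_sequence n \<Delta> (es0 @ ext)"
    and ext: "\<forall>e\<in>set ext. e \<subseteq> U" and U: "U \<subseteq> B" and card: "\<Delta>\<^sup>2 * g \<le> card (B - U)" and "1 \<le> g"
  shows "\<exists>V M. V \<subseteq> B - U \<and> card V = g \<and> card M = 2 \<and> ready V M (es0 @ ext) \<and>
    (\<forall>x\<in>V. spine \<Delta> V (set (es0 @ ext)) [x])"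
proof -
  let ?E = "set (es0 @ ext)" and ?C = "A (es0 @ ext)"
  note star = fresh_star[OF ext U]
  have C: "proper_edge_coloring \<Delta> ?E ?C" using proper_coloring[OF seq] .
  define missing where "missing x = {1..\<Delta>} - used ?C x" for x
  define T where "T = {M. M \<subseteq> {1..\<Delta>} \<and> card M = 2}"
  have finT: "finite T" unfolding T_def by simp
  have "card T \<le> \<Delta>\<^sup>2"
    using binomial_le_pow[OF degree_ge] n_subsets[of "{1..\<Delta>}" 2] by (simp add: T_def)
  have "missing ` (B - U) \<subseteq> T"
  proof
    fix M assume "M \<in> missing ` (B - U)"
    then obtain x where x: "x \<in> B - U" "M = missing x" by blast
    have "card (used ?C x) = \<Delta> - 2" using card_used[OF C] star(2)[OF x(1)] d by simp
    then have "card M = 2" using used_subset[OF C, of x] degree_ge unfolding x(2) missing_def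
      by (simp add: card_Diff_subset finite_subset)
    then show "M \<in> T" unfolding T_def x(2) missing_def by blast
  qed
  \<comment> \<open>The pigeonhole lemma needs a strict inequality, so it is applied with
    \<open>g - 1\<close> to obtain a fiber of at least \<open>g\<close> centers.\<close>
  moreover have "card T * (g - 1) < card (B - U)"
  proof -
    have "card T * (g - 1) \<le> \<Delta>\<^sup>2 * (g - 1)" using \<open>card T \<le> \<Delta>\<^sup>2\<close> by (rule mult_le_mono1)
    also have "\<dots> < \<Delta>\<^sup>2 * g" using \<open>1 \<le> g\<close> degree_ge by simp
    finally show ?thesis using card by simp
  qed
  ultimately obtain M where M: "M \<in> T" "g - 1 < card {x \<in> B - U. missing x = M}"
    using pigeonhole_fiber[OF finT] by metis
  then have "g \<le> card {x \<in> B - U. missing x = M}" by simp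
  then obtain V where V: "V \<subseteq> {x \<in> B - U. missing x = M}" "card V = g"
    by (rule obtain_subset_with_card_n)
  have "reserved \<Delta> ?C V M"
    unfolding reserved_def
  proof (intro conjI ballI allI impI)
    fix x c assume x: "x \<in> V" and c: "c \<in> {1..\<Delta>} - M"
    then have "c \<in> used ?C x" using V(1) unfolding missing_def by blast
    then obtain f where f: "x \<in> f" "?C f = Some c" unfolding used_def by blast
    then have "f \<in> {e \<in> ?E. x \<in> e}" using proper_dom[OF C] by blast
    then have "f \<in> (\<lambda>v. {x, v}) ` L x" using star(1) x V(1) by blast
    then have "\<not> f \<subseteq> V" using leaf_not_center x V(1) by blast
    with f show "\<exists>f. x \<in> f \<and> \<not> f \<subseteq> V \<and> ?C f = Some c" by blast
  next
    fix f c assume "f \<inter> V \<noteq> {}" "?C f = Some c"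
    then obtain x where "x \<in> V" "c \<in> used ?C x" unfolding used_def by blast
    then show "c \<notin> M" using V(1) unfolding missing_def by blast
  qed
  then have "ready V M (es0 @ ext)" using seq by (simp add: ready_def)
  moreover have "spine \<Delta> V ?E [x]" if "x \<in> V" for x
  proof -
    have x: "x \<in> B - U" using that V(1) by blast
    \<comment> \<open>The star of \<open>x\<close> serves as the separating set, and degree
      \<open>\<Delta> - 2\<close> leaves room for exactly the two path edges.\<close>
    have "insert x (L x) \<inter> V = {x}" using leaf_not_center x that V(1) by blast
    then show ?thesis using star(2,3)[OF x] degree_ge d unfolding spine_def by auto
  qed
  ultimately show ?thesis using V M(1) unfolding T_def by blast
qed

lemma many_groups:
  assumes degree: "2 \<le> \<Delta>" "d = \<Delta> - 2" and g: "g = 2 ^ Suc k - 1" and card: "2 * (\<Delta>\<^sup>2 * g) \<le> card B"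
    and "j \<le> Suc (card B div (2 * g))"
  shows "\<exists>ext U. insertion_sequence n \<Delta> (es0 @ ext) \<and> (\<forall>e\<in>set ext. e \<subseteq> U) \<and> U \<subseteq> B \<and>
    card U = j * g \<and> length ext \<le> card U \<and>
    j * (k * 2 ^ k + 2) \<le> total_recourse A (es0 @ ext) + j * 2 ^ Suc k"
  using assms(5)
proof (induction j)
  case 0
  show ?case by (intro exI[of _ "[]"] exI[of _ "{}"]) (simp add: seq0)
next
  case (Suc j)
  from Suc.prems have "j \<le> Suc (card B div (2 * g))" by simp
  from Suc.IH[OF this] obtain ext U where IH: "insertion_sequence n \<Delta> (es0 @ ext)" "\<forall>e\<in>set ext. e \<subseteq> U" "U \<subseteq> B"
    "card U = j * g" "length ext \<le> card U"
    "j * (k * 2 ^ k + 2) \<le> total_recourse A (es0 @ ext) + j * 2 ^ Suc k" by blast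
  have "1 \<le> g" unfolding g using one_le_power[of "2::nat" k] by (simp only: power_Suc) linarith
  have finU: "finite U" using finite_subset[OF IH(3) finite_centers] .
  \<comment> \<open>Before the next group at most half of the centers are used, so at least
    \<open>\<Delta>\<^sup>2 * g\<close> remain for the pigeonhole argument.\<close>
  have "j * (2 * g) \<le> card B div (2 * g) * (2 * g)" by (rule mult_le_mono1) (use Suc.prems in simp)
  also have "\<dots> \<le> card B" by (rule div_times_less_eq_dividend)
  finally have "2 * card U \<le> card B" using IH(4) by simp
  moreover have "card (B - U) = card B - card U" using finU IH(3) by (rule card_Diff_subset)
  ultimately have "\<Delta>\<^sup>2 * g \<le> card (B - U)" using card by simp
  then obtain V M where V: "V \<subseteq> B - U" "card V = g" "card M = 2" "ready V M (es0 @ ext)"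
    "\<And>x. x \<in> V \<Longrightarrow> spine \<Delta> V (set (es0 @ ext)) [x]"
    using uniform_group[OF degree IH(1-3) _ \<open>1 \<le> g\<close>] by meson
  have Vn: "V \<subseteq> {..<n}" using V(1) centers by blast
  have cV: "card V = 2 ^ Suc k - 1" using V(2) g by simp
  obtain ext' where ext': "ready V M ((es0 @ ext) @ ext')" "\<forall>e\<in>set ext'. e \<subseteq> V"
    "Suc (length ext') \<le> card V"
    "total_recourse A (es0 @ ext) + k * 2 ^ k + 2 \<le> total_recourse A ((es0 @ ext) @ ext') + 2 ^ Suc k"
    using build_spine[OF Vn V(3,4) subset_refl cV V(5)] by blast
  have "card (U \<union> V) = card U + card V"
    using V(1) finU finite_subset[of V B] finite_centers by (intro card_Un_disjoint) auto
  then have cU: "card (U \<union> V) = Suc j * g" using IH(4) V(2) by simp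
  show ?case
  proof (intro exI conjI)
    show "insertion_sequence n \<Delta> (es0 @ (ext @ ext'))" using ext'(1) by (simp add: ready_def)
    show "\<forall>e\<in>set (ext @ ext'). e \<subseteq> U \<union> V" using IH(2) ext'(2) by auto
    show "U \<union> V \<subseteq> B" using IH(3) V(1) by blast
    show "card (U \<union> V) = Suc j * g" by (rule cU)
    show "length (ext @ ext') \<le> card (U \<union> V)" using IH(4,5) ext'(3) V(2) cU by simp
    show "Suc j * (k * 2 ^ k + 2) \<le> total_recourse A (es0 @ (ext @ ext')) + Suc j * 2 ^ Suc k"
      using IH(6) ext'(4) by (simp add: algebra_simps)
  qed
qed

end

section \<open>Lower bounds for large and for bounded \<open>n / \<Delta> ^ 3\<close>\<close>

context shift_algorithm
begin

text \<open>Each star occupies the start of its own block of \<open>\<Delta>\<close> consecutive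
  vertices. The leaf count \<open>d\<close> will be \<open>\<Delta> - 2\<close> for the doubling
  argument and \<open>\<Delta> - 1\<close> for the two-star argument.\<close>

lemma star_blocks:
  assumes "d < \<Delta>" and Nn: "N * \<Delta> \<le> n"
  defines "B \<equiv> (\<lambda>i. i * \<Delta>) ` {..<N}" and "L \<equiv> \<lambda>b. {b<..b + d}"
  shows "\<exists>es. stars n \<Delta> A B L d es \<and> length es = N * d"
    and "card B = N"
    and "\<And>b. b \<in> B \<Longrightarrow> b + d < N * \<Delta>"
proof -
  show cardB: "card B = N" using assms(1) by (auto simp: B_def card_image inj_on_def)
  show bound: "b + d < N * \<Delta>" if b: "b \<in> B" for b
  proof -
    obtain i where i: "b = i * \<Delta>" "i < N" using b unfolding B_def by blast
    have "b + d < Suc i * \<Delta>" using i(1) assms(1) by simp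
    also have "\<dots> \<le> N * \<Delta>" using i(2) by (intro mult_le_mono1) simp
    finally show ?thesis .
  qed
  have disj: "disjoint_family_on (\<lambda>b. insert b (L b)) B"
    unfolding disjoint_family_on_def
  proof (intro ballI impI, rule ccontr)
    fix b c assume b: "b \<in> B" and c: "c \<in> B" and "b \<noteq> c"
      and "insert b (L b) \<inter> insert c (L c) \<noteq> {}"
    then obtain v where v: "v \<in> insert b (L b)" "v \<in> insert c (L c)" by blast
    \<comment> \<open>Any vertex of a star determines its center by rounding down to a multiple of
      \<open>\<Delta>\<close>, so distinct stars are disjoint.\<close>
    have "b = v div \<Delta> * \<Delta>" if "b \<in> B" "v \<in> insert b (L b)" for b
    proof -
      obtain i where i: "b = i * \<Delta>" using \<open>b \<in> B\<close> unfolding B_def by blast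
      have "i * \<Delta> \<le> v" "v < i * \<Delta> + \<Delta>" using that(2) assms(1) unfolding i L_def by auto
      then have "v div \<Delta> = i" by (intro div_nat_eqI) (simp_all add: mult.commute)
      then show ?thesis using i by simp
    qed
    then show False using b c v \<open>b \<noteq> c\<close> by metis
  qed
  have cardL: "card (L b) = d" for b unfolding L_def by simp
  have "\<exists>es. insertion_sequence n \<Delta> es \<and> set es = (\<Union>b\<in>B. (\<lambda>v. {b, v}) ` L b) \<and>
    length es = (\<Sum>b\<in>B. card (L b))"
  proof (rule add_stars[OF _ _ disj])
    fix b assume "b \<in> B"
    then show "b < n \<and> finite (L b) \<and> L b \<subseteq> {..<n} \<and> b \<notin> L b \<and> card (L b) \<le> \<Delta>"
      using bound[of b] assms(1) Nn cardL by (auto simp: L_def)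
  qed (simp add: B_def)
  then obtain es where es: "insertion_sequence n \<Delta> es"
    "set es = (\<Union>b\<in>B. (\<lambda>v. {b, v}) ` L b)" "length es = N * d"
    using cardB cardL by auto
  have "stars n \<Delta> A B L d es"
  proof
    show "B \<subseteq> {..<n}" using bound Nn by fastforce
    show "card (L b) = d \<and> b \<notin> L b" for b using cardL by (simp add: L_def)
  qed (fact disj es(1,2))+
  then show "\<exists>es. stars n \<Delta> A B L d es \<and> length es = N * d" using es(3) by blast
qed

text \<open>
  Joined directly, two stars with \<open>\<Delta> - 1\<close> leaves must miss the same color; joined through a fresh
  vertex, they must not.
\<close>

lemma one_recourse:
  assumes "2 \<le> \<Delta>" "2 * \<Delta> < n"
  shows "\<exists>es. insertion_sequence n \<Delta> es \<and> es \<noteq> [] \<and> length es \<le> 2 * \<Delta> \<and> 1 \<le> total_recourse A es"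
proof (rule ccontr)
  assume contr: "\<not> ?thesis"
  define B where "B = (\<lambda>i. i * \<Delta>) ` {..<2}"
  define L where "L b = {b<..b + (\<Delta> - 1)}" for b
  have blocks: "\<Delta> - 1 < \<Delta>" "2 * \<Delta> \<le> n" using assms by auto
  obtain es where "stars n \<Delta> A B L (\<Delta> - 1) es" and len: "length es = 2 * (\<Delta> - 1)"
    using star_blocks(1)[OF blocks] unfolding B_def L_def by blast
  then interpret stars n \<Delta> A B L "\<Delta> - 1" es by simp
  have B: "B = {0, \<Delta>}" by (auto simp: B_def numeral_2_eq_2 lessThan_Suc)
  have deg: "degree (set es) b = \<Delta> - 1" if "b \<in> {0, \<Delta>}" for b
    using fresh_star(2)[of "[]" "{}" b] that B by simp
  have w: "\<forall>e\<in>set es. 2 * \<Delta> \<notin> e"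
  proof (intro ballI notI)
    fix e assume "e \<in> set es" "2 * \<Delta> \<in> e"
    then obtain b where "b \<in> B" "2 * \<Delta> \<in> insert b (L b)" unfolding set0 by blast
    then show False using star_blocks(3)[OF blocks, of b] by (auto simp: B_def L_def)
  qed
  have deg_w: "degree (set es) (2 * \<Delta>) = 0"
  proof -
    have "{e \<in> set es. 2 * \<Delta> \<in> e} = {}" using w by blast
    then show ?thesis by (simp only: degree_def card.empty)
  qed
  have C: "proper_edge_coloring \<Delta> (set es) (A es)" using proper_coloring[OF seq0] .
  have miss: "card ({1..\<Delta>} - used (A es) b) = 1" if "b \<in> {0, \<Delta>}" for b
    using card_used[OF C, of b] deg[OF that] used_subset[OF C, of b] assms
    by (simp add: card_Diff_subset finite_subset)
  define S where "S = insert \<Delta> (L \<Delta>)"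
  have closed: "closed_under (set es) S"
    using fresh_star(3)[of "[]" "{}" \<Delta>] B by (simp add: S_def)
  have S: "\<Delta> \<in> S" "0 \<notin> S" "2 * \<Delta> \<notin> S" using assms(1) by (auto simp: S_def L_def)
  \<comment> \<open>Two alternative continuations of the same history \<open>es\<close>:
    \<open>es1\<close> joins the centers \<open>0\<close> and \<open>\<Delta>\<close> directly,
    \<open>es3\<close> joins them through the fresh vertex \<open>2 * \<Delta>\<close>. By
    determinism both start from the coloring \<open>A es\<close>.\<close>
  define es1 where "es1 = es @ [{\<Delta>, 0}]"
  define es2 where "es2 = es @ [{2 * \<Delta>, 0}]"
  define es3 where "es3 = es2 @ [{\<Delta>, 2 * \<Delta>}]"
  have es1: "insertion_sequence n \<Delta> es1"
    unfolding es1_def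
    by (rule insertion_sequence_snoc[OF seq0 _ _ closed]) (use assms deg S in auto)
  have es2: "insertion_sequence n \<Delta> es2"
    unfolding es2_def
    by (rule insertion_sequence_snoc[OF seq0, where S = "{2 * \<Delta>}"])
      (use assms deg w deg_w in \<open>auto simp: closed_under_def\<close>)
  have es3: "insertion_sequence n \<Delta> es3"
    unfolding es3_def
  proof (rule insertion_sequence_snoc[OF es2])
    show "closed_under (set es2) S"
      using closed S by (auto simp: es2_def closed_under_def)
    have "degree (set es2) \<Delta> \<le> degree (set es) \<Delta>"
      using degree_insert_le[of "set es" "{2 * \<Delta>, 0}" \<Delta>] assms(1) by (simp add: es2_def)
    then show "degree (set es2) \<Delta> < \<Delta>" using deg assms(1) by simp
    have "{e \<in> set es2. 2 * \<Delta> \<in> e} = {{2 * \<Delta>, 0}}" using w by (auto simp: es2_def)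
    then show "degree (set es2) (2 * \<Delta>) < \<Delta>" using assms(1) by (simp add: degree_def)
  qed (use assms S in auto)
  \<comment> \<open>The longest sequence considered is \<open>es3\<close>, with
    \<open>2 * (\<Delta> - 1) + 2 = 2 * \<Delta>\<close> edges, so the negated claim makes every
    insertion free.\<close>
  have free: "total_recourse A fs = 0" if "insertion_sequence n \<Delta> fs" "fs \<noteq> []" "length fs \<le> 2 * \<Delta>" for fs
    using contr that by (cases "total_recourse A fs") auto
  have "total_recourse A es1 = 0" "total_recourse A es3 = 0"
    using free[OF es1] free[OF es3] len assms(1) by (auto simp: es1_def es2_def es3_def)
  then have 0: "recourse (A es) (A es1) = 0" "recourse (A es) (A es2) = 0"
    "recourse (A es2) (A es3) = 0"
    by (auto simp: es1_def es2_def es3_def total_recourse_snoc simp del: append_assoc)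
  obtain x where x: "x \<in> {1..\<Delta>} - used (A es) 0" "x \<in> {1..\<Delta>} - used (A es) \<Delta>"
    using free_insertion(1)[OF es1[unfolded es1_def]] 0(1) unfolding es1_def by blast
  obtain y where y: "A es2 {2 * \<Delta>, 0} = Some y" "y \<in> {1..\<Delta>} - used (A es) 0"
    using free_insertion(1)[OF es2[unfolded es2_def]] 0(2) unfolding es2_def by blast
  obtain z where z: "z \<in> {1..\<Delta>} - used (A es2) \<Delta>" "z \<in> {1..\<Delta>} - used (A es2) (2 * \<Delta>)"
    using free_insertion(1)[OF es3[unfolded es3_def]] 0(3) unfolding es3_def by blast
  have "used (A es) \<Delta> \<subseteq> used (A es2) \<Delta>"
    using free_insertion(2)[OF es2[unfolded es2_def]] 0(2) unfolding es2_def by blast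
  then have "z \<in> {1..\<Delta>} - used (A es) \<Delta>" using z(1) by blast
  moreover have "a = b" if "card S = 1" "a \<in> S" "b \<in> S" for a b :: nat and S
    using that by (metis card_1_singletonE singletonD)
  \<comment> \<open>Each center misses exactly one color, and by the direct join it is the same
    color \<open>x\<close>. Both edges at the fresh vertex would then need it.\<close>
  ultimately have "z = x" "y = x" using miss[of 0] miss[of \<Delta>] x y(2) by blast+
  moreover have "y \<in> used (A es2) (2 * \<Delta>)" using y(1) unfolding used_def by blast
  ultimately show False using z(2) by blast
qed

text \<open>With \<open>j\<close> groups the recourse is at least
  \<open>j * (k - 2) * 2 ^ k\<close>, over the reals. The sequence has at most
  \<open>N * \<Delta>\<close> insertions, where \<open>N\<close> is at most
  \<open>4 * 2 ^ k * j\<close>; dividing gives the bound.\<close>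

lemma large_recourse:
  assumes "3 \<le> \<Delta>" and large: "\<Delta> ^ 3 * 2 ^ (k + 2) \<le> n"
  shows "\<exists>es. insertion_sequence n \<Delta> es \<and> es \<noteq> [] \<and>
    (real k - 2) / (4 * real \<Delta>) \<le> amortized_recourse A es"
proof -
  define N where "N = n div \<Delta>"
  have eq: "\<Delta> ^ 3 * 2 ^ (k + 2) = \<Delta>\<^sup>2 * 2 ^ (k + 2) * \<Delta>" by (simp add: power2_eq_square power3_eq_cube)
  have "\<Delta>\<^sup>2 * 2 ^ (k + 2) * \<Delta> \<le> n" using large unfolding eq .
  then have N: "\<Delta>\<^sup>2 * 2 ^ (k + 2) \<le> N"
    using assms(1) unfolding N_def by (subst less_eq_div_iff_mult_less_eq) auto
  have Nn: "N * \<Delta> \<le> n" unfolding N_def by (rule div_times_less_eq_dividend)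
  define B where "B = (\<lambda>i. i * \<Delta>) ` {..<N}"
  define L where "L b = {b<..b + (\<Delta> - 2)}" for b
  have blocks: "\<Delta> - 2 < \<Delta>" "N * \<Delta> \<le> n" using assms(1) Nn by auto
  have cardB: "card B = N" using star_blocks(2)[OF blocks] unfolding B_def .
  obtain es0 where "stars n \<Delta> A B L (\<Delta> - 2) es0" and len0: "length es0 = N * (\<Delta> - 2)"
    using star_blocks(1)[OF blocks] unfolding B_def L_def by blast
  then interpret stars n \<Delta> A B L "\<Delta> - 2" es0 by simp
  define g :: nat where "g = 2 ^ Suc k - 1"
  define j where "j = Suc (card B div (2 * g))"
  have "1 \<le> g" unfolding g_def using one_le_power[of "2::nat" k] by (simp only: power_Suc) linarith
  have g: "g \<le> 2 ^ Suc k" by (simp add: g_def)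
  have "2 * (\<Delta>\<^sup>2 * g) \<le> 2 * (\<Delta>\<^sup>2 * 2 ^ Suc k)" using g by simp
  also have "\<dots> \<le> card B" using N cardB by (simp add: mult_ac)
  finally have big: "2 * (\<Delta>\<^sup>2 * g) \<le> card B" .
  have "2 \<le> \<Delta>" using assms(1) by simp
  from many_groups[OF this refl g_def big order_refl, folded j_def]
  obtain ext U where ext: "insertion_sequence n \<Delta> (es0 @ ext)" "\<forall>e\<in>set ext. e \<subseteq> U" "U \<subseteq> B"
    "card U = j * g" "length ext \<le> card U"
    "j * (k * 2 ^ k + 2) \<le> total_recourse A (es0 @ ext) + j * 2 ^ Suc k"
    by blast
  let ?es = "es0 @ ext"
  have "card U \<le> N" using card_mono[OF finite_centers ext(3)] cardB by simp
  then have "length ?es \<le> N * (\<Delta> - 2) + N" using ext(5) len0 by simp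
  also have "\<dots> = N * Suc (\<Delta> - 2)" by simp
  also have "\<dots> \<le> N * \<Delta>" using assms(1) by (intro mult_le_mono2) simp
  also have "\<dots> \<le> 2 ^ (k + 2) * j * \<Delta>"
  proof (rule mult_le_mono1)
    \<comment> \<open>The \<open>j\<close> groups exceed half of the \<open>N\<close> centers, and
      each has at most \<open>2 ^ Suc k\<close> of them.\<close>
    have "N < Suc (N div (2 * g)) * (2 * g)"
      using \<open>1 \<le> g\<close> dividend_less_div_times[of "2 * g" N] by simp
    also have "\<dots> \<le> j * 2 ^ (k + 2)" unfolding j_def cardB using g by (intro mult_le_mono) simp_all
    finally show "N \<le> 2 ^ (k + 2) * j" by (simp add: mult.commute)
  qed
  finally have "real (length ?es) \<le> real (2 ^ (k + 2) * j * \<Delta>)" by (rule of_nat_mono)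
  then have len: "real (length ?es) \<le> 4 * 2 ^ k * real j * real \<Delta>" by simp
  have "0 < \<Delta>\<^sup>2 * 2 ^ (k + 2)" using assms(1) by simp
  then have "0 < N" using N by (rule less_le_trans)
  then have pos: "0 < length ?es" using len0 assms(1) by simp
  have "real (j * (k * 2 ^ k + 2)) \<le> real (total_recourse A ?es + j * 2 ^ Suc k)"
    using ext(6) by (rule of_nat_mono)
  then have tot: "(real k - 2) * (2 ^ k * real j) \<le> real (total_recourse A ?es)"
    by (simp add: algebra_simps)
  have "(real k - 2) / (4 * real \<Delta>) * real (length ?es) \<le> real (total_recourse A ?es)"
  proof (cases "2 \<le> k")
    case True
    then have "(real k - 2) / (4 * real \<Delta>) * real (length ?es)
        \<le> (real k - 2) / (4 * real \<Delta>) * (4 * 2 ^ k * real j * real \<Delta>)"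
      using len by (intro mult_left_mono) auto
    also have "\<dots> = (real k - 2) * (2 ^ k * real j)" using assms(1) by (simp add: field_simps)
    finally show ?thesis using tot by simp
  next
    \<comment> \<open>For \<open>k < 2\<close> the left side is not positive, so the bound is
      immediate.\<close>
    case False
    then have "(real k - 2) / (4 * real \<Delta>) * real (length ?es) \<le> 0"
      by (intro mult_nonpos_nonneg divide_nonpos_nonneg) auto
    then show ?thesis by (meson of_nat_0_le_iff order_trans)
  qed
  then have "(real k - 2) / (4 * real \<Delta>) \<le> amortized_recourse A ?es"
    unfolding amortized_recourse_def using pos by (subst pos_le_divide_eq) (simp_all only: of_nat_0_less_iff)
  then show ?thesis using ext(1) pos by blast
qed

lemma small_recourse:
  assumes "2 \<le> \<Delta>" "2 * \<Delta> < n"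
  shows "\<exists>es. insertion_sequence n \<Delta> es \<and> es \<noteq> [] \<and> 1 / (2 * real \<Delta>) \<le> amortized_recourse A es"
proof -
  obtain es where es: "insertion_sequence n \<Delta> es" "es \<noteq> []" "length es \<le> 2 * \<Delta>"
    "1 \<le> total_recourse A es"
    using one_recourse[OF assms] by blast
  have "1 / (2 * real \<Delta>) \<le> 1 / real (length es)"
    using es(2,3) assms(1) by (intro divide_left_mono mult_pos_pos) auto
  also have "\<dots> \<le> amortized_recourse A es"
    unfolding amortized_recourse_def using es(4) by (intro divide_right_mono) auto
  finally show ?thesis using es by blast
qed

text \<open>For \<open>n < \<Delta> ^ 3\<close> the logarithm is negative and a single edge
  suffices. Otherwise the number of binary digits of \<open>n div \<Delta> ^ 3\<close> decides
  between the doubling argument and the two-star argument.\<close>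

lemma amortized_lower_bound:
  assumes "3 \<le> \<Delta>" "2 \<le> n"
  shows "\<exists>es. es \<noteq> [] \<and> insertion_sequence n \<Delta> es \<and>
    1 / 24 * (1 / real \<Delta> * ln (real n / real \<Delta> ^ 3)) \<le> amortized_recourse A es"
proof (cases "n < \<Delta> ^ 3")
  case True
  have "insertion_sequence n \<Delta> ([] @ [{0, 1}])"
    by (rule insertion_sequence_snoc[where S = "{0}"])
      (use assms in \<open>auto simp: insertion_sequence.empty closed_under_def degree_def\<close>)
  moreover have "ln (real n / real \<Delta> ^ 3) \<le> 0"
  proof -
    have "real n \<le> real \<Delta> ^ 3" using True by (metis of_nat_power of_nat_mono less_imp_le)
    then show ?thesis using assms by simp
  qed
  then have "1 / 24 * (1 / real \<Delta> * ln (real n / real \<Delta> ^ 3)) \<le> 0"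
    by (simp add: divide_nonpos_nonneg)
  moreover have "0 \<le> amortized_recourse A [{0, 1}]" by (simp add: amortized_recourse_def)
  ultimately show ?thesis by (intro exI[of _ "[{0, 1}]"]) auto
next
  case False
  then have "1 \<le> n div \<Delta> ^ 3" using assms(1) by (simp add: Suc_le_eq div_greater_zero_iff)
  \<comment> \<open>Here \<open>m\<close> is the binary logarithm of
    \<open>n div \<Delta> ^ 3\<close>, rounded down; since \<open>ln 2 < 1\<close>, the natural
    logarithm in the claim is at most \<open>m + 1\<close>.\<close>
  then obtain m where m: "2 ^ m \<le> n div \<Delta> ^ 3" "n div \<Delta> ^ 3 < 2 ^ (m + 1)"
    using ex_power_ivl1[of 2 "n div \<Delta> ^ 3"] by auto
  have pos: "0 < \<Delta> ^ 3" using assms(1) by simp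
  have lower: "\<Delta> ^ 3 * 2 ^ m \<le> n"
    using m(1) pos by (simp add: less_eq_div_iff_mult_less_eq mult.commute)
  have "n < 2 ^ (m + 1) * \<Delta> ^ 3" using m(2) pos by (simp add: div_less_iff_less_mult)
  then have "real n < real (2 ^ (m + 1) * \<Delta> ^ 3)" by (rule of_nat_less_iff[THEN iffD2])
  then have "real n / real \<Delta> ^ 3 \<le> 2 ^ (m + 1)"
    using pos by (simp add: pos_divide_le_eq)
  moreover have "0 < real n / real \<Delta> ^ 3" using assms by simp
  ultimately have "ln (real n / real \<Delta> ^ 3) \<le> ln (2 ^ (m + 1))" by simp
  also have "\<dots> = real (m + 1) * ln 2" by (rule ln_realpow)
  also have "\<dots> \<le> real (m + 1) * 1" using ln_2_less_1 by (intro mult_left_mono) auto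
  finally have "ln (real n / real \<Delta> ^ 3) \<le> real m + 1" by simp
  then have bound: "1 / 24 * (1 / real \<Delta> * ln (real n / real \<Delta> ^ 3)) \<le> (real m + 1) / (24 * real \<Delta>)"
    using assms(1) by (simp add: divide_right_mono)
  \<comment> \<open>Taking \<open>k = m - 2\<close> in \<open>large_recourse\<close> gives
    \<open>(m - 4) / (4 * \<Delta>)\<close>, which is at least
    \<open>(m + 1) / (24 * \<Delta>)\<close> precisely from \<open>m = 5\<close> on. For smaller
    \<open>m\<close> the latter is at most \<open>5 / (24 * \<Delta>)\<close>, below the
    \<open>1 / (2 * \<Delta>)\<close> of \<open>small_recourse\<close>.\<close>
  show ?thesis
  proof (cases "5 \<le> m")
    case True
    then have "m - 2 + 2 = m" by simp
    then have "\<Delta> ^ 3 * 2 ^ (m - 2 + 2) \<le> n" using lower by (simp only:)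
    then obtain es where es: "insertion_sequence n \<Delta> es" "es \<noteq> []"
      "(real (m - 2) - 2) / (4 * real \<Delta>) \<le> amortized_recourse A es"
      using large_recourse[OF assms(1)] by blast
    have "(real m + 1) / (24 * real \<Delta>) \<le> (real (m - 2) - 2) / (4 * real \<Delta>)"
      using True assms(1) by (simp add: field_simps of_nat_diff)
    then show ?thesis using es bound by (meson order_trans)
  next
    case m5: False
    \<comment> \<open>The two-star argument needs \<open>2 * \<Delta> + 1\<close> vertices;
      \<open>n\<close> is at least \<open>\<Delta> ^ 3\<close>, hence at least
      \<open>9 * \<Delta>\<close>.\<close>
    have "3 * (3 * \<Delta>) \<le> \<Delta> * (\<Delta> * \<Delta>)" using assms(1) by (intro mult_le_mono) auto
    then have "9 * \<Delta> \<le> \<Delta> ^ 3" by (simp add: power3_eq_cube)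
    then have "2 * \<Delta> < n" using False assms(1) by linarith
    then obtain es where es: "insertion_sequence n \<Delta> es" "es \<noteq> []"
      "1 / (2 * real \<Delta>) \<le> amortized_recourse A es"
      using small_recourse assms(1) by auto
    have "(real m + 1) / (24 * real \<Delta>) \<le> 1 / (2 * real \<Delta>)"
      using m5 assms(1) by (simp add: field_simps)
    then show ?thesis using es bound by (meson order_trans)
  qed
qed

end

theorem theorem3p12:
  shows "\<exists>k>0::real. \<forall>\<Delta>\<ge>3::nat. \<forall>n\<ge>2::nat. \<forall>A :: algorithm.
    maintains_proper_coloring n \<Delta> A \<and> shift_based n \<Delta> A \<longrightarrow>
    (\<exists>es. es \<noteq> [] \<and> insertion_sequence n \<Delta> es \<and>
       amortized_recourse A es \<ge> k * (1 / real \<Delta> * ln (real n / real \<Delta> ^ 3)))"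
proof (intro exI[of _ "1 / 24"] conjI allI impI)
  fix \<Delta> n :: nat and A :: algorithm
  assume "3 \<le> \<Delta>" "2 \<le> n" "maintains_proper_coloring n \<Delta> A \<and> shift_based n \<Delta> A"
  then interpret shift_algorithm n \<Delta> A by unfold_locales auto
  show "\<exists>es. es \<noteq> [] \<and> insertion_sequence n \<Delta> es \<and>
       amortized_recourse A es \<ge> 1 / 24 * (1 / real \<Delta> * ln (real n / real \<Delta> ^ 3))"
    by (rule amortized_lower_bound) fact+
qed simp

end
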